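(* Let $(X,B)\in\mathbb{K}^{n\times p}\times\mathbb{K}^{n\times p}$ and $\mathbb{S}\in\{\mathbb{J},\mathbb{L}\}$. Then there is a matrix $A\in\mathbb{S}$ such that $AX=B$ if and only if (a) $BX^\dagger X=B$ and (b) the following condition holds: Bilinear form: - $M^T=M$, $\mathbb{S}=\mathbb{J}$: $(X^TMB)^T=X^TMB$; - $M^T=M$, $\mathbb{S}=\mathbb{L}$: $(X^TMB)^T=-X^TMB$; - $M^T=-M$, $\mathbb{S}=\mathbb{J}$: $(X^TMB)^T=-X^TMB$; - $M^T=-M$, $\mathbb{S}=\mathbb{L}$: $(X^TMB)^T=X^TMB$. Sesquilinear form: - $M^H=M$, $\mathbb{S}=\mathbb{J}$: $(X^HMB)^H=X^HMB$; - $M^H=M$, $\mathbb{S}=\mathbb{L}$: $(X^HMB)^H=-X^HMB$; - $M^H=-M$, $\mathbb{S}=\mathbb{J}$: $(X^HMB)^H=-X^HMB$; - $M^H=-M$, $\mathbb{S}=\mathbb{L}$: $(X^HMB)^H=X^HMB$.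
   Context: $\mathbb{K}=\mathbb{R}$ or $\mathbb{C}$; $X^T$, $X^H$ and $X^\dagger$ denote the transpose, conjugate transpose and Moore-Penrose pseudoinverse of $X$. Let $M\in\mathbb{K}^{n\times n}$ be unitary. Consider the scalar product on $\mathbb{K}^n$ given by $\langle x,y\rangle_M=y^TMx$ (bilinear form; then it is assumed that $M^T=M$ or $M^T=-M$) or $\langle x,y\rangle_M=y^HMx$ (sesquilinear form; $\mathbb{K}=\mathbb{C}$, and it is assumed that $M^H=M$ or $M^H=-M$). The adjoint of $A\in\mathbb{K}^{n\times n}$ is $A^\star=M^{-1}A^TM$ for a bilinear form and $A^\star=M^{-1}A^HM$ for a sesquilinear form. The Lie algebra is $\mathbb{L}=\{A\in\mathbb{K}^{n\times n}:A^\star=-A\}$ and the Jordan algebra is $\mathbb{J}=\{A\in\mathbb{K}^{n\times n}:A^\star=A\}$. *)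

theory Defs
  imports "HOL-Analysis.Analysis" "Jordan_Normal_Form.Conjugate"
begin

text \<open>
  The class \<^class>\<open>conjugate\<close> provides \<^const>\<open>conjugate\<close>, which is \<^const>\<open>cnj\<close> on
  complex numbers and the identity on real numbers, so that one definition serves both
  scalar fields. A $n \times p$ matrix has the type \<open>'a^'p^'n\<close>.
\<close>

definition ctranspose :: "'a::conjugate^'n^'m \<Rightarrow> 'a^'m^'n" where
  "ctranspose A = (\<chi> i j. conjugate (A $ j $ i))"

lemma ctranspose_real [simp]: "ctranspose (A :: real^'n^'m) = transpose A"
  by (simp add: ctranspose_def transpose_def)

definition unitary :: "'a::{conjugate,semiring_1}^'n^'n \<Rightarrow> bool" where
  "unitary M \<longleftrightarrow> ctranspose M ** M = mat 1 \<and> M ** ctranspose M = mat 1"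

lemma unitary_real: "unitary (M :: real^'n^'n) \<longleftrightarrow> orthogonal_matrix M"
  by (simp add: unitary_def orthogonal_matrix_def)

definition is_pinv :: "'a::{conjugate,semiring_1}^'n^'m \<Rightarrow> 'a^'m^'n \<Rightarrow> bool" where
  "is_pinv X Y \<longleftrightarrow> X ** Y ** X = X \<and> Y ** X ** Y = Y \<and>
     ctranspose (X ** Y) = X ** Y \<and> ctranspose (Y ** X) = Y ** X"

text \<open>Existence and uniqueness of the described matrix are proved in \<open>ex1_pinv\<close> below.\<close>

definition pinv :: "'a::{conjugate,semiring_1}^'n^'m \<Rightarrow> 'a^'m^'n" where
  "pinv X = (THE Y. is_pinv X Y)"

definition bilin_adjoint :: "'a::semiring_1^'n^'n \<Rightarrow> 'a^'n^'n \<Rightarrow> 'a^'n^'n" where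
  "bilin_adjoint M A = matrix_inv M ** transpose A ** M"

definition sesqui_adjoint :: "'a::{conjugate,semiring_1}^'n^'n \<Rightarrow> 'a^'n^'n \<Rightarrow> 'a^'n^'n" where
  "sesqui_adjoint M A = matrix_inv M ** ctranspose A ** M"

text \<open>The argument of the next two definitions is an adjoint map $A \mapsto A^\star$.\<close>

definition lie_algebra :: "('a::ab_group_add^'n^'n \<Rightarrow> 'a^'n^'n) \<Rightarrow> ('a^'n^'n) set" where
  "lie_algebra star = {A. star A = - A}"

definition jordan_algebra :: "('a^'n^'n \<Rightarrow> 'a^'n^'n) \<Rightarrow> ('a^'n^'n) set" where
  "jordan_algebra star = {A. star A = A}"


subsection \<open>The Moore-Penrose pseudoinverse is well defined\<close>

lemma ctranspose_ctranspose [simp]: "ctranspose (ctranspose A) = A"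
  by (simp add: ctranspose_def vec_eq_iff)

lemma ctranspose_mult:
  "ctranspose (A ** B) = ctranspose B ** ctranspose (A :: 'a::conjugatable_field^'n^'m)"
  by (simp add: ctranspose_def matrix_matrix_mult_def vec_eq_iff sum_conjugate
      conjugate_dist_mul mult.commute)

lemma ctranspose_mult_self_eq_0:
  fixes W :: "'a::conjugatable_ordered_field^'n^'m"
  assumes "ctranspose W ** W = 0"
  shows "W = 0"
proof -
  have "W $ i $ j = 0" for i j
  proof -
    have "(\<Sum>k\<in>UNIV. W $ k $ j * conjugate (W $ k $ j)) = (ctranspose W ** W) $ j $ j"
      by (simp add: ctranspose_def matrix_matrix_mult_def mult.commute)
    also have "\<dots> = 0"
      using assms by simp
    finally have "\<forall>k\<in>UNIV. W $ k $ j * conjugate (W $ k $ j) = 0"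
      by (subst (asm) sum_nonneg_eq_0_iff) (auto intro: conjugate_square_positive)
    then show ?thesis by simp
  qed
  then show ?thesis by (simp add: vec_eq_iff)
qed

lemma matrix_diff_ldistrib: "A ** (U - V) = A ** U - A ** (V :: 'a::ring_1^'n^'m)"
  by (simp add: matrix_matrix_mult_def vec_eq_iff right_diff_distrib sum_subtractf)

lemma gram_cancel:
  fixes X :: "'a::conjugatable_ordered_field^'n^'m"
  assumes "ctranspose X ** X ** U = ctranspose X ** X ** V"
  shows "X ** U = X ** V"
proof -
  have "ctranspose X ** (X ** (U - V)) = 0"
    using assms by (simp add: matrix_mul_assoc matrix_diff_ldistrib)
  then have "ctranspose (U - V) ** (ctranspose X ** (X ** (U - V))) = 0"
    by (simp add: matrix_matrix_mult_def vec_eq_iff)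
  then have "ctranspose (X ** (U - V)) ** (X ** (U - V)) = 0"
    by (simp add: ctranspose_mult matrix_mul_assoc)
  then have "X ** (U - V) = 0"
    by (rule ctranspose_mult_self_eq_0)
  then show ?thesis by (simp add: matrix_diff_ldistrib)
qed

lemma ex_inner_inverse: "\<exists>G. A ** G ** A = (A :: 'a::field^'n^'m)"
proof -
  obtain g where g: "Vector_Spaces.linear (*s) (*s) g" "\<forall>v\<in>range ((*v) A). A *v g v = v"
    using vec.linear_exists_right_inverse_on[OF matrix_vector_mul_linear_gen[of A] vec.subspace_UNIV]
    by blast
  have "(A ** matrix g ** A) *v x = A *v x" for x
    using g(2) by (simp add: matrix_vector_mul_assoc[symmetric] matrix_works[OF g(1)])
  then show ?thesis by (metis matrix_eq)
qed

lemma is_pinv_unique: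
  fixes X :: "'a::conjugatable_field^'n^'m"
  assumes "is_pinv X Y" "is_pinv X Z"
  shows "Y = Z"
proof -
  have 1: "X ** Y = X ** Z"
  proof -
    have "X ** Y = ctranspose ((X ** Z) ** (X ** Y))"
      using assms by (metis is_pinv_def matrix_mul_assoc)
    also have "\<dots> = (X ** Y) ** (X ** Z)"
      using assms by (simp add: is_pinv_def ctranspose_mult[of "X ** Z"])
    also have "\<dots> = X ** Z"
      using assms by (metis is_pinv_def matrix_mul_assoc)
    finally show ?thesis .
  qed
  have 2: "Y ** X = Z ** X"
  proof -
    have "Y ** X = ctranspose ((Y ** X) ** (Z ** X))"
      using assms by (metis is_pinv_def matrix_mul_assoc)
    also have "\<dots> = (Z ** X) ** (Y ** X)"
      using assms by (simp add: is_pinv_def ctranspose_mult[of "Y ** X"])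
    also have "\<dots> = Z ** X"
      using assms by (metis is_pinv_def matrix_mul_assoc)
    finally show ?thesis .
  qed
  show ?thesis
    using assms 1 2 by (metis is_pinv_def matrix_mul_assoc)
qed

lemma ex_is_pinv: "\<exists>Y. is_pinv (X :: 'a::conjugatable_ordered_field^'n^'m) Y"
proof -
  let ?H = "ctranspose X"
  obtain P where P: "(?H ** X) ** P ** (?H ** X) = ?H ** X"
    using ex_inner_inverse by blast
  obtain Q where Q: "(X ** ?H) ** Q ** (X ** ?H) = X ** ?H"
    using ex_inner_inverse by blast
  define E where "E = X ** P ** ?H"
  define F where "F = ?H ** Q ** X"
  have EX: "E ** X = X"
    using gram_cancel[of X "P ** ?H ** X" "mat 1"] P by (simp add: E_def matrix_mul_assoc)
  have XF: "X ** F = X"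
  proof -
    have "X ** ?H ** (ctranspose Q ** X ** ?H) = X ** ?H"
      using arg_cong[OF Q, of ctranspose] by (simp add: ctranspose_mult matrix_mul_assoc)
    then have "?H ** (ctranspose Q ** X ** ?H) = ?H"
      using gram_cancel[of ?H "ctranspose Q ** X ** ?H" "mat 1"] by simp
    from arg_cong[OF this, of ctranspose] show ?thesis
      by (simp add: F_def ctranspose_mult matrix_mul_assoc)
  qed
  have "E ** ctranspose E = E"
    using arg_cong[OF EX, of ctranspose]
    by (simp add: E_def ctranspose_mult matrix_mul_assoc[symmetric])
  then have E: "ctranspose E = E"
    by (metis ctranspose_ctranspose ctranspose_mult)
  have "ctranspose F ** F = F"
    using arg_cong[OF XF, of ctranspose]
    by (simp add: F_def ctranspose_mult matrix_mul_assoc)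
  then have F: "ctranspose F = F"
    by (metis ctranspose_ctranspose ctranspose_mult)
  define Y where "Y = F ** P ** ?H"
  have XY: "X ** Y = E"
    using XF by (simp add: Y_def E_def matrix_mul_assoc)
  have YX: "Y ** X = F"
  proof -
    have "Y ** X = ?H ** Q ** (E ** X)"
      by (simp add: Y_def E_def F_def matrix_mul_assoc)
    then show ?thesis using EX by (simp add: F_def)
  qed
  have "F ** F = F"
    using XF by (metis F_def matrix_mul_assoc)
  then have "F ** Y = Y"
    by (simp add: Y_def matrix_mul_assoc)
  then have "is_pinv X Y"
    using XY YX E F EX by (simp add: is_pinv_def)
  then show ?thesis by blast
qed

lemma ex1_pinv: "\<exists>!Y. is_pinv (X :: 'a::conjugatable_ordered_field^'n^'m) Y"
  using ex_is_pinv is_pinv_unique by blast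

lemma is_pinv_pinv: "is_pinv (X :: 'a::conjugatable_ordered_field^'n^'m) (pinv X)"
  unfolding pinv_def by (rule theI') (rule ex1_pinv)

end

theory Submission
  imports Defs
begin

text \<open>
  Put $S = MA$ and $C = MB$. Then $A$ is in the Jordan or Lie algebra iff $S$ is symmetric or
  skew (with respect to the chosen transposition), and $AX = B$ iff $SX = C$, so everything
  reduces to $SX = C$ with $S^\sigma = \varepsilon S$. The matrix
  $S = K + \varepsilon K^\sigma (1 - XG)$ with $K = CG$ solves this whenever $XGX = X$.
\<close>

text \<open>
  Bilinear forms correspond to the identity involution, sesquilinear forms to \<^const>\<open>cnj\<close>.
\<close>

definition invol_transpose :: "('a \<Rightarrow> 'a) \<Rightarrow> 'a^'n^'m \<Rightarrow> 'a^'m^'n" where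
  "invol_transpose \<sigma> A = (\<chi> i j. \<sigma> (A $ j $ i))"

text \<open>Linearity is meant over the reals: \<open>cnj\<close> is not complex-linear, and the
  only scalars that have to pass through \<sigma> are the real signs below.\<close>

definition ring_involution :: "('a::real_field \<Rightarrow> 'a) \<Rightarrow> bool" where
  "ring_involution \<sigma> \<longleftrightarrow>
     linear \<sigma> \<and> (\<forall>a b. \<sigma> (a * b) = \<sigma> a * \<sigma> b) \<and> (\<forall>a. \<sigma> (\<sigma> a) = a)"

lemma ring_involution_id: "ring_involution (id :: 'a::real_field \<Rightarrow> 'a)"
  by (simp add: ring_involution_def linear_id)

lemma ring_involution_cnj: "ring_involution cnj"
  by (simp add: ring_involution_def bounded_linear.linear[OF bounded_linear_cnj])

lemma transpose_conv_invol: "transpose A = invol_transpose id A"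
  by (simp add: transpose_def invol_transpose_def)

lemma ctranspose_conv_invol: "ctranspose A = invol_transpose cnj (A :: complex^'n^'m)"
  by (simp add: ctranspose_def invol_transpose_def)

lemma matrix_diff_rdistrib: "(U - V) ** A = U ** A - V ** (A :: 'a::ring_1^'n^'m)"
  by (simp add: matrix_matrix_mult_def vec_eq_iff left_diff_distrib sum_subtractf)

lemma matrix_add_rdistrib: "(U + V) ** A = U ** A + V ** (A :: 'a::semiring_1^'n^'m)"
  by (simp add: matrix_matrix_mult_def vec_eq_iff distrib_right sum.distrib)

lemma
  fixes M :: "'a::semiring_1^'n^'m"
  assumes "invertible M"
  shows matrix_inv_right: "M ** matrix_inv M = mat 1"
    and matrix_inv_left: "matrix_inv M ** M = mat 1"
  using someI_ex[OF assms[unfolded invertible_def]] by (simp_all add: matrix_inv_def)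

lemma invertible_mult_left_cancel:
  fixes M :: "'a::semiring_1^'n^'m"
  assumes "invertible M"
  shows "M ** U = M ** V \<longleftrightarrow> U = V"
proof
  assume "M ** U = M ** V"
  then have "(matrix_inv M ** M) ** U = (matrix_inv M ** M) ** V"
    by (simp flip: matrix_mul_assoc)
  then show "U = V" by (simp add: matrix_inv_left assms)
qed simp

context
  fixes \<sigma> :: "'a::real_field \<Rightarrow> 'a"
  assumes \<sigma>: "ring_involution \<sigma>"
begin

lemma invol_transpose_invol_transpose: "invol_transpose \<sigma> (invol_transpose \<sigma> A) = A"
  using \<sigma> by (simp add: ring_involution_def invol_transpose_def vec_eq_iff)

lemma invol_transpose_mult:
  "invol_transpose \<sigma> (A ** B) = invol_transpose \<sigma> B ** invol_transpose \<sigma> A"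
  using \<sigma> by (simp add: ring_involution_def invol_transpose_def matrix_matrix_mult_def
      vec_eq_iff linear_sum mult.commute)

lemma invol_transpose_add:
  "invol_transpose \<sigma> (A + B) = invol_transpose \<sigma> A + invol_transpose \<sigma> B"
  using \<sigma> by (simp add: ring_involution_def invol_transpose_def vec_eq_iff linear_add)

lemma invol_transpose_diff:
  "invol_transpose \<sigma> (A - B) = invol_transpose \<sigma> A - invol_transpose \<sigma> B"
  using \<sigma> by (simp add: ring_involution_def invol_transpose_def vec_eq_iff linear_diff)

lemma invol_transpose_scaleR: "invol_transpose \<sigma> (c *\<^sub>R A) = c *\<^sub>R invol_transpose \<sigma> A"
  using \<sigma> by (simp add: ring_involution_def invol_transpose_def vec_eq_iff linear_cmul)

text \<open>The real number \<epsilon> with square 1 is a sign, so the symmetric and the skew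
  problem are solved together. Necessity: if \<open>S ** X = C\<close>, then
  \<open>C ** G ** X = S ** (X ** G ** X) = C\<close>, and the product of \<open>X\<close>
  transposed with \<open>C\<close> is a congruence transform of \<open>S\<close>, which inherits its
  symmetry. Sufficiency uses the explicit \<open>S\<close> from the introduction, with its last
  factor multiplied out.\<close>

lemma ex_eps_symmetric_iff:
  assumes G: "X ** G ** X = X" and \<epsilon>: "\<epsilon> * \<epsilon> = (1::real)"
  shows "(\<exists>S. invol_transpose \<sigma> S = \<epsilon> *\<^sub>R S \<and> S ** X = C) \<longleftrightarrow>
    C ** G ** X = C \<and>
    invol_transpose \<sigma> (invol_transpose \<sigma> X ** C) = \<epsilon> *\<^sub>R (invol_transpose \<sigma> X ** C)"
    (is "?L \<longleftrightarrow> ?R")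
proof
  assume ?L
  then obtain S where "invol_transpose \<sigma> S = \<epsilon> *\<^sub>R S" and "S ** X = C" by blast
  then show ?R
    using G by (auto simp: invol_transpose_mult invol_transpose_invol_transpose
        matrix_scalar_ac simp flip: scalar_matrix_assoc matrix_mul_assoc)
next
  assume R: ?R
  let ?T = "invol_transpose \<sigma>"
  define K where "K = C ** G"
  define S where "S = K + \<epsilon> *\<^sub>R (?T K - ?T K ** X ** G)"
  have KX: "K ** X = C"
    using R by (simp add: K_def)
  \<comment> \<open>The part of \<open>S\<close> added to \<open>K\<close> annihilates
    \<open>X\<close> because \<open>X ** G ** X = X\<close>; hence \<open>S\<close> acts on
    \<open>X\<close> as \<open>K\<close> does.\<close>
  have "(?T K - ?T K ** X ** G) ** X = ?T K ** X - ?T K ** (X ** G ** X)"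
    by (simp add: matrix_diff_rdistrib matrix_mul_assoc)
  then have SX: "S ** X = C"
    by (simp add: S_def matrix_add_rdistrib KX G scalar_matrix_assoc[symmetric])
  have "?T C ** X = \<epsilon> *\<^sub>R (?T X ** C)"
    using R by (simp add: invol_transpose_mult invol_transpose_invol_transpose)
  \<comment> \<open>Multiplying by \<open>?T G\<close> on the left and by \<open>G\<close> on the
    right carries the symmetry condition from \<open>C\<close> over to
    \<open>K = C ** G\<close>.\<close>
  then have "?T G ** (?T C ** X) ** G = \<epsilon> *\<^sub>R (?T G ** ?T X ** K)"
    by (simp add: K_def matrix_scalar_ac matrix_mul_assoc flip: scalar_matrix_assoc)
  then have "?T K ** X ** G = \<epsilon> *\<^sub>R (?T G ** ?T X ** K)"
    by (simp add: K_def invol_transpose_mult matrix_mul_assoc)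
  \<comment> \<open>The right-hand side above is \<epsilon> times the transpose of
    \<open>?T K ** X ** G\<close>. As \<epsilon> is its own inverse, this matrix is itself
    \<epsilon>-symmetric.\<close>
  then have "?T (?T K ** X ** G) = \<epsilon> *\<^sub>R (?T K ** X ** G)"
    using \<epsilon> by (simp add: invol_transpose_mult invol_transpose_invol_transpose invol_transpose_scaleR
        matrix_mul_assoc)
  \<comment> \<open>Transposition sends \<open>K\<close> to \<open>?T K\<close> and back, so
    \<open>K + \<epsilon> *\<^sub>R ?T K\<close> is \<epsilon>-symmetric, and so is the multiple of
    \<open>?T K ** X ** G\<close> subtracted from it.\<close>
  then have "?T S = \<epsilon> *\<^sub>R S"
    using \<epsilon> by (simp add: S_def invol_transpose_add invol_transpose_diff invol_transpose_scaleR
        invol_transpose_invol_transpose scaleR_add_right scaleR_diff_right)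
  then show ?L using SX by blast
qed

text \<open>Left multiplication by the invertible \<open>M\<close> is a bijection that turns the
  structure of \<open>A\<close> into a symmetry of \<open>M ** A\<close>. Since \<open>M\<close>
  itself contributes the sign \<delta> when \<open>M ** A\<close> is transposed, the resulting sign
  is the product of \<delta> and \<eta>, which explains the pattern of signs in the theorem.\<close>

lemma ex_structured_iff:
  fixes M :: "'a^'n^'n" and X B :: "'a^'p^'n"
  assumes G: "X ** G ** X = X" and M: "invertible M"
    and \<delta>: "\<delta> * \<delta> = (1::real)" "invol_transpose \<sigma> M = \<delta> *\<^sub>R M" and \<eta>: "\<eta> * \<eta> = (1::real)"
  shows "(\<exists>A. matrix_inv M ** invol_transpose \<sigma> A ** M = \<eta> *\<^sub>R A \<and> A ** X = B) \<longleftrightarrow>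
    B ** G ** X = B \<and>
    invol_transpose \<sigma> (invol_transpose \<sigma> X ** M ** B) =
      (\<delta> * \<eta>) *\<^sub>R (invol_transpose \<sigma> X ** M ** B)"
proof -
  let ?T = "invol_transpose \<sigma>"
  note cancel = invertible_mult_left_cancel[OF M]
  have "matrix_inv M ** ?T A ** M = \<eta> *\<^sub>R A \<longleftrightarrow> ?T (M ** A) = (\<delta> * \<eta>) *\<^sub>R (M ** A)" for A
  proof -
    have "matrix_inv M ** ?T A ** M = \<eta> *\<^sub>R A \<longleftrightarrow>
        M ** (matrix_inv M ** ?T A ** M) = M ** (\<eta> *\<^sub>R A)"
      by (simp only: cancel)
    also have "\<dots> \<longleftrightarrow> ?T A ** M = \<eta> *\<^sub>R (M ** A)"
      by (simp add: matrix_mul_assoc matrix_inv_right M matrix_scalar_ac scalar_matrix_assoc)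
    \<comment> \<open>The scalar \<delta> is nonzero because its square is 1. It is inserted so that
      \<delta> times \<open>M\<close> can be replaced by the transpose of \<open>M\<close>.\<close>
    also have "\<dots> \<longleftrightarrow> \<delta> *\<^sub>R (?T A ** M) = \<delta> *\<^sub>R \<eta> *\<^sub>R (M ** A)"
      using \<delta>(1) by (subst scaleR_cancel_left) auto
    finally show ?thesis
      using \<delta> by (simp add: invol_transpose_mult matrix_scalar_ac flip: scalar_matrix_assoc)
  qed
  moreover have "A ** X = B \<longleftrightarrow> (M ** A) ** X = M ** B" for A
    by (simp add: cancel flip: matrix_mul_assoc)
  ultimately have
    "(\<exists>A. matrix_inv M ** ?T A ** M = \<eta> *\<^sub>R A \<and> A ** X = B) \<longleftrightarrow>
     (\<exists>A. ?T (M ** A) = (\<delta> * \<eta>) *\<^sub>R (M ** A) \<and> (M ** A) ** X = M ** B)"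
    by simp
  \<comment> \<open>Quantifying over all \<open>M ** A\<close> is quantifying over all matrices,
    since \<open>S\<close> arises from \<open>A = matrix_inv M ** S\<close>.\<close>
  also have "\<dots> \<longleftrightarrow> (\<exists>S. ?T S = (\<delta> * \<eta>) *\<^sub>R S \<and> S ** X = M ** B)"
  proof -
    have "S = M ** (matrix_inv M ** S)" for S :: "'a^'n^'n"
      by (simp add: matrix_mul_assoc matrix_inv_right M)
    then show ?thesis by metis
  qed
  also have "\<dots> \<longleftrightarrow> M ** B ** G ** X = M ** B \<and>
      ?T (?T X ** (M ** B)) = (\<delta> * \<eta>) *\<^sub>R (?T X ** (M ** B))"
    using \<delta> \<eta> by (intro ex_eps_symmetric_iff G) (simp add: mult.assoc mult.left_commute[of \<eta>])
  also have "M ** B ** G ** X = M ** B \<longleftrightarrow> B ** G ** X = B"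
    by (simp add: cancel flip: matrix_mul_assoc)
  finally show ?thesis by (simp add: matrix_mul_assoc)
qed

end

lemma invertible_unitary: "unitary M \<Longrightarrow> invertible M"
  unfolding unitary_def invertible_def by blast

lemma pinv_inner_inverse: "X ** pinv X ** X = (X :: 'a::conjugatable_ordered_field^'n^'m)"
  using is_pinv_pinv[of X] by (simp add: is_pinv_def)

text \<open>One block of the theorem, for an arbitrary involution. The sort joins
  \<open>real_field\<close>, needed for the signs, with \<open>conjugatable_ordered_field\<close>,
  over which \<open>pinv\<close> is known to exist; \<open>star\<close> is a variable so that either
  adjoint can be substituted.\<close>

lemma jordan_lie_iff:
  fixes M :: "'a::{real_field,conjugatable_ordered_field}^'n^'n"
  assumes \<sigma>: "ring_involution \<sigma>"
    and star: "star = (\<lambda>A. matrix_inv M ** invol_transpose \<sigma> A ** M)"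
  shows
    "unitary M \<longrightarrow>
      (invol_transpose \<sigma> M = M \<longrightarrow>
        ((\<exists>A \<in> jordan_algebra star. A ** X = B) \<longleftrightarrow>
          B ** pinv X ** X = B \<and>
          invol_transpose \<sigma> (invol_transpose \<sigma> X ** M ** B) = invol_transpose \<sigma> X ** M ** B) \<and>
        ((\<exists>A \<in> lie_algebra star. A ** X = B) \<longleftrightarrow>
          B ** pinv X ** X = B \<and>
          invol_transpose \<sigma> (invol_transpose \<sigma> X ** M ** B) = - (invol_transpose \<sigma> X ** M ** B))) \<and>
      (invol_transpose \<sigma> M = - M \<longrightarrow>
        ((\<exists>A \<in> jordan_algebra star. A ** X = B) \<longleftrightarrow>
          B ** pinv X ** X = B \<and>
          invol_transpose \<sigma> (invol_transpose \<sigma> X ** M ** B) = - (invol_transpose \<sigma> X ** M ** B)) \<and>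
        ((\<exists>A \<in> lie_algebra star. A ** X = B) \<longleftrightarrow>
          B ** pinv X ** X = B \<and>
          invol_transpose \<sigma> (invol_transpose \<sigma> X ** M ** B) = invol_transpose \<sigma> X ** M ** B))"
proof (intro impI conjI)
  assume "unitary M"
  note iff = ex_structured_iff[OF \<sigma> pinv_inner_inverse[of X] invertible_unitary[OF this],
      where B = B]
  note defs = jordan_algebra_def lie_algebra_def star Bex_def
  {
    assume *: "invol_transpose \<sigma> M = M"
    show "(\<exists>A \<in> jordan_algebra star. A ** X = B) \<longleftrightarrow> B ** pinv X ** X = B \<and>
        invol_transpose \<sigma> (invol_transpose \<sigma> X ** M ** B) = invol_transpose \<sigma> X ** M ** B"
      \<comment> \<open>In each of the four cases the first value is \<delta>, the sign of
        \<open>M\<close> under transposition, and the second is \<eta>, which is 1 for the Jordan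
        algebra and -1 for the Lie algebra.\<close>
      using iff[of 1 1] * by (simp add: defs)
    show "(\<exists>A \<in> lie_algebra star. A ** X = B) \<longleftrightarrow> B ** pinv X ** X = B \<and>
        invol_transpose \<sigma> (invol_transpose \<sigma> X ** M ** B) = - (invol_transpose \<sigma> X ** M ** B)"
      using iff[of 1 "-1"] * by (simp add: defs)
  next
    assume *: "invol_transpose \<sigma> M = - M"
    show "(\<exists>A \<in> jordan_algebra star. A ** X = B) \<longleftrightarrow> B ** pinv X ** X = B \<and>
        invol_transpose \<sigma> (invol_transpose \<sigma> X ** M ** B) = - (invol_transpose \<sigma> X ** M ** B)"
      using iff[of "-1" 1] * by (simp add: defs)
    show "(\<exists>A \<in> lie_algebra star. A ** X = B) \<longleftrightarrow> B ** pinv X ** X = B \<and>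
        invol_transpose \<sigma> (invol_transpose \<sigma> X ** M ** B) = invol_transpose \<sigma> X ** M ** B"
      using iff[of "-1" "-1"] * by (simp add: defs)
  }
qed

lemma bilin_adjoint_conv_invol:
  "bilin_adjoint M = (\<lambda>A. matrix_inv M ** invol_transpose id A ** M)"
  by (simp add: fun_eq_iff bilin_adjoint_def transpose_conv_invol)

lemma sesqui_adjoint_conv_invol:
  "sesqui_adjoint M = (\<lambda>A. matrix_inv M ** invol_transpose cnj A ** M)"
  by (simp add: fun_eq_iff sesqui_adjoint_def ctranspose_conv_invol)

theorem theorem3p1:
  fixes M :: "complex^'n^'n" and X B :: "complex^'p^'n"
    and Mr :: "real^'n^'n" and Xr Br :: "real^'p^'n"
  shows
    "(unitary Mr \<longrightarrow>
      (transpose Mr = Mr \<longrightarrow>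
        ((\<exists>A \<in> jordan_algebra (bilin_adjoint Mr). A ** Xr = Br) \<longleftrightarrow>
          Br ** pinv Xr ** Xr = Br \<and>
          transpose (transpose Xr ** Mr ** Br) = transpose Xr ** Mr ** Br) \<and>
        ((\<exists>A \<in> lie_algebra (bilin_adjoint Mr). A ** Xr = Br) \<longleftrightarrow>
          Br ** pinv Xr ** Xr = Br \<and>
          transpose (transpose Xr ** Mr ** Br) = - (transpose Xr ** Mr ** Br))) \<and>
      (transpose Mr = - Mr \<longrightarrow>
        ((\<exists>A \<in> jordan_algebra (bilin_adjoint Mr). A ** Xr = Br) \<longleftrightarrow>
          Br ** pinv Xr ** Xr = Br \<and>
          transpose (transpose Xr ** Mr ** Br) = - (transpose Xr ** Mr ** Br)) \<and>
        ((\<exists>A \<in> lie_algebra (bilin_adjoint Mr). A ** Xr = Br) \<longleftrightarrow>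
          Br ** pinv Xr ** Xr = Br \<and>
          transpose (transpose Xr ** Mr ** Br) = transpose Xr ** Mr ** Br))) \<and>
     (unitary M \<longrightarrow>
      (transpose M = M \<longrightarrow>
        ((\<exists>A \<in> jordan_algebra (bilin_adjoint M). A ** X = B) \<longleftrightarrow>
          B ** pinv X ** X = B \<and>
          transpose (transpose X ** M ** B) = transpose X ** M ** B) \<and>
        ((\<exists>A \<in> lie_algebra (bilin_adjoint M). A ** X = B) \<longleftrightarrow>
          B ** pinv X ** X = B \<and>
          transpose (transpose X ** M ** B) = - (transpose X ** M ** B))) \<and>
      (transpose M = - M \<longrightarrow>
        ((\<exists>A \<in> jordan_algebra (bilin_adjoint M). A ** X = B) \<longleftrightarrow>
          B ** pinv X ** X = B \<and>
          transpose (transpose X ** M ** B) = - (transpose X ** M ** B)) \<and>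
        ((\<exists>A \<in> lie_algebra (bilin_adjoint M). A ** X = B) \<longleftrightarrow>
          B ** pinv X ** X = B \<and>
          transpose (transpose X ** M ** B) = transpose X ** M ** B))) \<and>
     (unitary M \<longrightarrow>
      (ctranspose M = M \<longrightarrow>
        ((\<exists>A \<in> jordan_algebra (sesqui_adjoint M). A ** X = B) \<longleftrightarrow>
          B ** pinv X ** X = B \<and>
          ctranspose (ctranspose X ** M ** B) = ctranspose X ** M ** B) \<and>
        ((\<exists>A \<in> lie_algebra (sesqui_adjoint M). A ** X = B) \<longleftrightarrow>
          B ** pinv X ** X = B \<and>
          ctranspose (ctranspose X ** M ** B) = - (ctranspose X ** M ** B))) \<and>
      (ctranspose M = - M \<longrightarrow>
        ((\<exists>A \<in> jordan_algebra (sesqui_adjoint M). A ** X = B) \<longleftrightarrow>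
          B ** pinv X ** X = B \<and>
          ctranspose (ctranspose X ** M ** B) = - (ctranspose X ** M ** B)) \<and>
        ((\<exists>A \<in> lie_algebra (sesqui_adjoint M). A ** X = B) \<longleftrightarrow>
          B ** pinv X ** X = B \<and>
          ctranspose (ctranspose X ** M ** B) = ctranspose X ** M ** B)))"
  unfolding transpose_conv_invol ctranspose_conv_invol
  \<comment> \<open>The three blocks are, in order, real bilinear, complex bilinear and complex
    sesquilinear forms.\<close>
  by (rule conjI[OF jordan_lie_iff[OF ring_involution_id bilin_adjoint_conv_invol]
        conjI[OF jordan_lie_iff[OF ring_involution_id bilin_adjoint_conv_invol]
          jordan_lie_iff[OF ring_involution_cnj sesqui_adjoint_conv_invol]]])

end
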